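(* Let $d = p_1^{\varepsilon_1}p_2^{\varepsilon_2}\cdots p_r^{\varepsilon_r}$, where $r\ge 1$, $p_1,\dots,p_r$ are distinct primes and $\varepsilon_1,\dots,\varepsilon_r\ge 1$ are integers, and let $d_k := p_k^{\varepsilon_k}$. Let $(b,c)\in\mathbb{Z}_d^2$ be a vector with degree $\delta=(\delta_1,\dots,\delta_r)$, and let $K$ be the set of those indices $k\in\{1,\dots,r\}$ for which the component vector $(b^{(k)},c^{(k)})\in\mathbb{Z}_{d_k}^2$ equals $(0,0)$. Then: (a) The number of points of the projective line $\mathbb{P}_1(\mathbb{Z}_d)$ which contain the vector $(b,c)$ equals $$\prod_{j\in\{1,\dots,r\}\setminus K} p_j^{\delta_j}\cdot\prod_{k\in K}\left(p_k^{\varepsilon_k}+p_k^{\varepsilon_k-1}\right).$$ (b) The perp-set $(b,c)^\perp$ has cardinality $$|(b,c)^\perp| = \prod_{k=1}^{r}p_k^{\varepsilon_k+\delta_k} = d\cdot\prod_{k=1}^{r}p_k^{\delta_k}.$$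
   Context: $\mathbb{Z}_n$ denotes the ring of integers modulo $n$. For $x\in\mathbb{Z}_d$, $x^{(k)}\in\mathbb{Z}_{d_k}$ denotes its reduction modulo $d_k$ (so $\mathbb{Z}_d\cong\mathbb{Z}_{d_1}\times\cdots\times\mathbb{Z}_{d_r}$ by the Chinese remainder theorem), and the component vectors of $(b,c)\in\mathbb{Z}_d^2$ are $(b^{(k)},c^{(k)})\in\mathbb{Z}_{d_k}^2$. Degree: for a prime power $p^{\varepsilon}$ (with $\varepsilon\ge1$), the degree of a vector $(b,c)\in\mathbb{Z}_{p^\varepsilon}^2$ is the largest $\kappa\in\{0,1,\dots,\varepsilon\}$ such that both $b$ and $c$ lie in the ideal $\mathbb{Z}_{p^\varepsilon}\cdot p^\kappa$ (in particular the zero vector has degree $\varepsilon$, since $p^\varepsilon=0$). For general $d$, the degree of $(b,c)\in\mathbb{Z}_d^2$ is the $r$-tuple $(\delta_1,\dots,\delta_r)$, where $\delta_k$ is the degree of $(b^{(k)},c^{(k)})\in\mathbb{Z}_{d_k}^2$. Points: a vector $(x,y)\in\mathbb{Z}_d^2$ is called admissible if the map $\mathbb{Z}_d\to\mathbb{Z}_d^2$, $u\mapsto(ux,uy)$, is injective. A point of the projective line $\mathbb{P}_1(\mathbb{Z}_d)$ is a free cyclic submodule $\mathbb{Z}_d(x,y)=\{(ux,uy):u\in\mathbb{Z}_d\}$ with $(x,y)$ admissible, regarded as a set of vectors; $\mathbb{P}_1(\mathbb{Z}_d)$ is the set of all points. Perp-set: on $\mathbb{Z}_d^2$ let $[(b,c),(b',c')]:=cb'-c'b\in\mathbb{Z}_d$.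 Then $(b,c)^\perp:=\{(u,v)\in\mathbb{Z}_d^2:[(b,c),(u,v)]=0\}$. *)

theory Defs
  imports "HOL-Number_Theory.Residues" "HOL-Algebra.Ideal"
begin

text \<open>
  The ring of integers modulo \<open>n\<close> is \<open>residue_ring (int n)\<close>, with carrier \<open>{0..int n - 1}\<close>; it is
  the intended ring only for \<open>n \<ge> 2\<close> (for \<open>n = 1\<close> its unit \<open>1\<close> lies outside the carrier).
\<close>

abbreviation Zmod :: "nat \<Rightarrow> int ring"
  where "Zmod n \<equiv> residue_ring (int n)"

abbreviation vecs :: "('a, 'm) ring_scheme \<Rightarrow> ('a \<times> 'a) set"
  where "vecs R \<equiv> carrier R \<times> carrier R"

definition scale :: "('a, 'm) ring_scheme \<Rightarrow> 'a \<Rightarrow> 'a \<times> 'a \<Rightarrow> 'a \<times> 'a"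
  where "scale R u v = (u \<otimes>\<^bsub>R\<^esub> fst v, u \<otimes>\<^bsub>R\<^esub> snd v)"

definition admissible :: "('a, 'm) ring_scheme \<Rightarrow> 'a \<times> 'a \<Rightarrow> bool"
  where "admissible R v \<longleftrightarrow> v \<in> vecs R \<and> inj_on (\<lambda>u. scale R u v) (carrier R)"

definition cyclic_submodule :: "('a, 'm) ring_scheme \<Rightarrow> 'a \<times> 'a \<Rightarrow> ('a \<times> 'a) set"
  where "cyclic_submodule R v = {scale R u v | u. u \<in> carrier R}"

definition proj_line :: "('a, 'm) ring_scheme \<Rightarrow> ('a \<times> 'a) set set"
  where "proj_line R = {cyclic_submodule R v | v. admissible R v}"

definition symp :: "('a, 'm) ring_scheme \<Rightarrow> 'a \<times> 'a \<Rightarrow> 'a \<times> 'a \<Rightarrow> 'a"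
  where "symp R v w = (snd v \<otimes>\<^bsub>R\<^esub> fst w) \<ominus>\<^bsub>R\<^esub> (snd w \<otimes>\<^bsub>R\<^esub> fst v)"

definition perp :: "('a, 'm) ring_scheme \<Rightarrow> 'a \<times> 'a \<Rightarrow> ('a \<times> 'a) set"
  where "perp R v = {w \<in> vecs R. symp R v w = \<zero>\<^bsub>R\<^esub>}"

definition reduce_vec :: "nat \<Rightarrow> int \<times> int \<Rightarrow> int \<times> int"
  where "reduce_vec n v = (fst v mod int n, snd v mod int n)"

text \<open>
  The generator of the ideal has to be given as a residue: for \<open>\<kappa> = e\<close> the integer \<open>p ^ \<kappa>\<close> is not in
  the carrier, and its residue is \<open>0\<close>.
\<close>

definition prime_power_degree :: "nat \<Rightarrow> nat \<Rightarrow> int \<times> int \<Rightarrow> nat"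
  where "prime_power_degree p e v =
    Max {\<kappa> \<in> {0..e}.
      fst v \<in> PIdl\<^bsub>Zmod (p ^ e)\<^esub> (int (p ^ \<kappa>) mod int (p ^ e)) \<and>
      snd v \<in> PIdl\<^bsub>Zmod (p ^ e)\<^esub> (int (p ^ \<kappa>) mod int (p ^ e))}"

text \<open>
  The degree of a vector modulo \<open>p 1 ^ \<epsilon> 1 * \<dots> * p r ^ \<epsilon> r\<close> is a tuple indexed by \<open>{1..r}\<close>;
  the following is its \<open>k\<close>-th entry.
\<close>

definition vec_degree :: "(nat \<Rightarrow> nat) \<Rightarrow> (nat \<Rightarrow> nat) \<Rightarrow> int \<times> int \<Rightarrow> nat \<Rightarrow> nat"
  where "vec_degree p \<epsilon> v k = prime_power_degree (p k) (\<epsilon> k) (reduce_vec (p k ^ \<epsilon> k) v)"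

end

theory Submission
  imports Defs
begin

text \<open>
  Every point has exactly \<open>card (Units R)\<close> admissible generators, so the number of points
  containing \<open>v\<close> times \<open>\<phi>(d)\<close> is the number of admissible \<open>w\<close> with \<open>v \<in> R w\<close>. Over
  \<open>\<int>/d\<close> admissible means unimodular, and by Bezout \<open>v\<close> is a multiple of a unimodular \<open>w\<close> iff
  the determinant of \<open>v\<close> and \<open>w\<close> vanishes. Hence both this set and the perp-set are cut out by
  congruences, and the Chinese remainder theorem reduces the counting to prime powers. There
  \<open>v = p\<^sup>\<delta> (x, y)\<close> with \<open>x\<close> or \<open>y\<close> a unit if \<open>\<delta> < \<epsilon>\<close>, so that the vanishing of the determinant
  determines one coordinate of \<open>w\<close> modulo \<open>p\<^bsup>\<epsilon>-\<delta>\<^esup>\<close> in terms of the other.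
\<close>

section \<open>Generators of points over a commutative ring\<close>

lemma scale_closed:
  assumes "cring R" "u \<in> carrier R" "v \<in> vecs R"
  shows "scale R u v \<in> vecs R"
proof -
  interpret cring R by fact
  show ?thesis using assms by (auto simp: scale_def)
qed

lemma scale_scale:
  assumes "cring R" "u \<in> carrier R" "t \<in> carrier R" "v \<in> vecs R"
  shows "scale R u (scale R t v) = scale R (u \<otimes>\<^bsub>R\<^esub> t) v"
proof -
  interpret cring R by fact
  show ?thesis using assms by (auto simp: scale_def m_assoc)
qed

lemma scale_one:
  assumes "cring R" "v \<in> vecs R"
  shows "scale R \<one>\<^bsub>R\<^esub> v = v"
proof -
  interpret cring R by fact
  show ?thesis using assms by (auto simp: scale_def)
qed

lemma self_in_cyclic_submodule:
  assumes "cring R" "v \<in> vecs R"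
  shows "v \<in> cyclic_submodule R v"
proof -
  interpret cring R by fact
  show ?thesis using scale_one[OF assms] by (force simp: cyclic_submodule_def)
qed

text \<open>If \<open>v\<close> and \<open>w\<close> generate the same submodule, each is a multiple
  of the other, so \<open>v = t u v\<close>, and injectivity of scaling \<open>v\<close> forces
  \<open>t u = 1\<close>. Conversely, a unit factor can be cancelled, so it spoils neither
  admissibility nor the span.\<close>

lemma generators_of_point:
  assumes R: "cring R" and v: "admissible R v"
  shows "{w. admissible R w \<and> cyclic_submodule R w = cyclic_submodule R v}
       = (\<lambda>u. scale R u v) ` Units R"
proof (intro equalityI subsetI)
  interpret cring R by fact
  have vR: "v \<in> vecs R" and inj: "inj_on (\<lambda>u. scale R u v) (carrier R)"
    using v by (auto simp: admissible_def)
  {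
    fix w assume "w \<in> {w. admissible R w \<and> cyclic_submodule R w = cyclic_submodule R v}"
    then have w: "admissible R w" "cyclic_submodule R w = cyclic_submodule R v" by auto
    then have wR: "w \<in> vecs R" by (simp add: admissible_def)
    obtain u where u: "u \<in> carrier R" "w = scale R u v"
      using self_in_cyclic_submodule[OF R wR] w(2) by (auto simp: cyclic_submodule_def)
    obtain t where t: "t \<in> carrier R" "v = scale R t w"
      using self_in_cyclic_submodule[OF R vR] w(2) by (auto simp: cyclic_submodule_def)
    have "scale R (t \<otimes>\<^bsub>R\<^esub> u) v = scale R \<one>\<^bsub>R\<^esub> v"
      using u(2) t(2) scale_scale[OF R t(1) u(1) vR] scale_one[OF R vR] by metis
    then have "t \<otimes>\<^bsub>R\<^esub> u = \<one>\<^bsub>R\<^esub>"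
      using inj_onD[OF inj] t(1) u(1) by simp
    then have "u \<in> Units R"
      using t(1) u(1) m_comm[of u t] by (auto simp: Units_def)
    then show "w \<in> (\<lambda>u. scale R u v) ` Units R"
      using u(2) by blast
  next
    fix w assume "w \<in> (\<lambda>u. scale R u v) ` Units R"
    then obtain u where u: "u \<in> Units R" "w = scale R u v" by blast
    have uR: "u \<in> carrier R" using u by blast
    have sc: "scale R t w = scale R (t \<otimes>\<^bsub>R\<^esub> u) v" if "t \<in> carrier R" for t
      using scale_scale[OF R that uR vR] u by simp
    have "inj_on (\<lambda>t. scale R t w) (carrier R)"
    proof (rule inj_onI)
      fix s t assume st: "s \<in> carrier R" "t \<in> carrier R" "scale R s w = scale R t w"
      then have "s \<otimes>\<^bsub>R\<^esub> u = t \<otimes>\<^bsub>R\<^esub> u"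
        using inj_onD[OF inj] uR by (simp add: sc)
      then have "u \<otimes>\<^bsub>R\<^esub> s = u \<otimes>\<^bsub>R\<^esub> t"
        using st uR by (simp add: m_comm)
      then show "s = t" using st u(1) by simp
    qed
    then have "admissible R w"
      using scale_closed[OF R uR vR] u(2) by (simp add: admissible_def)
    moreover have "cyclic_submodule R w = cyclic_submodule R v"
    proof (intro equalityI subsetI)
      fix z assume "z \<in> cyclic_submodule R w"
      then show "z \<in> cyclic_submodule R v"
        using uR by (force simp: cyclic_submodule_def sc)
    next
      fix z assume "z \<in> cyclic_submodule R v"
      then obtain t where t: "t \<in> carrier R" "z = scale R t v"
        by (auto simp: cyclic_submodule_def)
      have "scale R (t \<otimes>\<^bsub>R\<^esub> inv\<^bsub>R\<^esub> u) w = z"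
        using t u(1) uR by (simp add: sc m_assoc)
      moreover have "t \<otimes>\<^bsub>R\<^esub> inv\<^bsub>R\<^esub> u \<in> carrier R" using t u by simp
      ultimately show "z \<in> cyclic_submodule R w"
        unfolding cyclic_submodule_def by blast
    qed
    ultimately show "w \<in> {w. admissible R w \<and> cyclic_submodule R w = cyclic_submodule R v}"
      by simp
  }
qed

text \<open>Double counting: sorting the admissible \<open>w\<close> with \<open>v\<close> in their
  span by the point they generate gives one block per point containing \<open>v\<close>, and each
  block is a free orbit of the unit group.\<close>

lemma card_Units_times_card_points:
  assumes R: "cring R" and fin: "finite (carrier R)"
  shows "card (Units R) * card {L \<in> proj_line R. v \<in> L}
       = card {w. admissible R w \<and> v \<in> cyclic_submodule R w}"
proof -
  define G where "G = (\<lambda>L. {w. admissible R w \<and> cyclic_submodule R w = L})"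
  let ?S = "{L \<in> proj_line R. v \<in> L}"
  have U: "Units R \<subseteq> carrier R" by (auto simp: Units_def)
  have finA: "finite {w. admissible R w \<and> v \<in> cyclic_submodule R w}"
    by (rule finite_subset[of _ "vecs R"]) (use fin in \<open>auto simp: admissible_def\<close>)
  \<comment> \<open>\<open>G L\<close> is nonempty for a point \<open>L\<close>, and every member of
    it generates \<open>L\<close>, so \<open>L\<close> can be recovered.\<close>
  have inj: "inj_on G ?S"
    by (rule inj_onI) (auto simp: G_def proj_line_def)
  have Un: "\<Union>(G ` ?S) = {w. admissible R w \<and> v \<in> cyclic_submodule R w}"
    by (auto simp: G_def proj_line_def)
  have "card (G L) = card (Units R)" if L: "L \<in> ?S" for L
  proof -
    obtain w where w: "admissible R w" "L = cyclic_submodule R w"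
      using L by (auto simp: proj_line_def)
    have "G L = (\<lambda>u. scale R u w) ` Units R"
      using generators_of_point[OF R w(1)] w(2) by (simp add: G_def)
    moreover have "inj_on (\<lambda>u. scale R u w) (Units R)"
      using w(1) U by (auto simp: admissible_def intro: inj_on_subset)
    ultimately show ?thesis by (simp add: card_image)
  qed
  moreover have "finite (G ` ?S)"
  proof (rule finite_subset)
    show "G ` ?S \<subseteq> Pow {w. admissible R w \<and> v \<in> cyclic_submodule R w}"
      by (auto simp: G_def)
  qed (use finA in simp)
  ultimately have "card (Units R) * card (G ` ?S) = card (\<Union>(G ` ?S))"
    by (intro card_partition) (use finA in \<open>auto simp: Un, auto simp: G_def\<close>)
  then show ?thesis
    by (simp only: Un card_image[OF inj])
qed

section \<open>Points and perp-sets over the integers modulo n\<close>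

lemma residues_Zmod: "n > 1 \<Longrightarrow> residues (int n)"
  by unfold_locales simp

lemma carrier_residue_ring: "carrier (residue_ring m) = {0..<m}"
  by (auto simp: residue_ring_def)

lemma mult_residue_ring: "x \<otimes>\<^bsub>residue_ring m\<^esub> y = (x * y) mod m"
  by (simp add: residue_ring_def)

lemma card_Units_Zmod:
  assumes "n > 1"
  shows "card (Units (Zmod n)) = totient n"
proof -
  interpret residues "int n" "Zmod n" using residues_Zmod[OF assms] by simp
  have "Units (Zmod n) = int ` totatives n"
  proof (intro equalityI subsetI)
    fix x assume "x \<in> Units (Zmod n)"
    then have "x = int (nat x)" "nat x \<in> totatives n"
      by (auto simp: res_units_eq totatives_def simp flip: coprime_int_iff)
    then show "x \<in> int ` totatives n" by blast
  next
    fix x assume "x \<in> int ` totatives n"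
    then obtain k where "x = int k" "k \<in> totatives n" by blast
    \<comment> \<open>\<open>totatives n\<close> runs up to \<open>n\<close> inclusive;
      \<open>n\<close> itself is excluded because \<open>n > 1\<close>.\<close>
    moreover have "k < n" using totatives_less[of k n] calculation assms by simp
    ultimately show "x \<in> Units (Zmod n)"
      by (auto simp: res_units_eq totatives_def)
  qed
  then show ?thesis by (simp add: card_image totient_def)
qed

text \<open>A condition on integer representatives rather than on ring elements: it also makes sense
  modulo 1 and for unreduced vectors, as Chinese remaindering requires.\<close>

definition unimodular :: "nat \<Rightarrow> int \<times> int \<Rightarrow> bool"
  where "unimodular n w \<longleftrightarrow> coprime (gcd (fst w) (snd w)) (int n)"

text \<open>The integer form of the vanishing of \<open>symp\<close>, again meaningful for unreduced
  vectors.\<close>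

definition collinear :: "nat \<Rightarrow> int \<times> int \<Rightarrow> int \<times> int \<Rightarrow> bool"
  where "collinear n v w \<longleftrightarrow> int n dvd fst w * snd v - snd w * fst v"

text \<open>A Bezout relation for the gcd of the coordinates, multiplied by an inverse of that gcd
  modulo \<open>n\<close>.\<close>

lemma unimodular_bezout:
  assumes "unimodular n w"
  obtains s t where "[s * fst w + t * snd w = 1] (mod int n)"
proof -
  obtain s t where "s * fst w + t * snd w = gcd (fst w) (snd w)"
    using bezout_int by blast
  moreover obtain x where "[gcd (fst w) (snd w) * x = 1] (mod int n)"
    using assms cong_solve_coprime_int unfolding unimodular_def by blast
  moreover have "(s * x) * fst w + (t * x) * snd w = (s * fst w + t * snd w) * x"
    by (simp add: algebra_simps)
  ultimately have "[(s * x) * fst w + (t * x) * snd w = 1] (mod int n)"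
    by simp
  then show ?thesis using that by blast
qed

text \<open>A common divisor \<open>g > 1\<close> of both coordinates and \<open>n\<close> yields
  the nonzero scalar \<open>n / g\<close>, which kills \<open>w\<close>. In the other direction a
  Bezout relation recovers the scalar \<open>u\<close> from the multiple \<open>u w\<close>.\<close>

lemma admissible_Zmod_iff:
  assumes n: "n > 1"
  shows "admissible (Zmod n) w \<longleftrightarrow> w \<in> vecs (Zmod n) \<and> unimodular n w"
proof (cases "w \<in> vecs (Zmod n)")
  case True
  obtain x y where w: "w = (x, y)" by fastforce
  have "inj_on (\<lambda>u. scale (Zmod n) u w) (carrier (Zmod n)) \<longleftrightarrow> unimodular n w"
  proof
    assume inj: "inj_on (\<lambda>u. scale (Zmod n) u w) (carrier (Zmod n))"
    define g where "g = gcd (gcd x y) (int n)"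
    have g0: "g > 0" using n by (simp add: g_def)
    obtain k where k: "int n = g * k" unfolding g_def by (meson dvdE gcd_dvd2)
    have k0: "k > 0" using k g0 n zero_less_mult_pos[of g k] by simp
    obtain x' y' where xy: "x = g * x'" "y = g * y'"
      unfolding g_def by (meson dvdE dvd_trans gcd_dvd1 gcd_dvd2)
    have "g = 1"
    proof (rule ccontr)
      assume "g \<noteq> 1"
      then have "k < int n" using g0 k k0 by simp
      moreover have "int n dvd k * x" "int n dvd k * y" by (auto simp: k xy)
      then have "scale (Zmod n) k w = scale (Zmod n) 0 w"
        by (simp add: scale_def w mult_residue_ring)
      ultimately have "k = 0"
        using inj k0 n by (auto simp: carrier_residue_ring dest!: inj_onD)
      then show False using k0 by simp
    qed
    then show "unimodular n w"
      by (simp add: unimodular_def w g_def coprime_iff_gcd_eq_1)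
  next
    assume "unimodular n w"
    then obtain s t where st: "[s * x + t * y = 1] (mod int n)"
      using unimodular_bezout[OF \<open>unimodular n w\<close>] unfolding w by auto
    show "inj_on (\<lambda>u. scale (Zmod n) u w) (carrier (Zmod n))"
    proof (rule inj_onI)
      fix u u' assume u: "u \<in> carrier (Zmod n)" "u' \<in> carrier (Zmod n)"
        and eq: "scale (Zmod n) u w = scale (Zmod n) u' w"
      have e: "[u * x = u' * x] (mod int n)" "[u * y = u' * y] (mod int n)"
        using eq by (auto simp: scale_def mult_residue_ring w cong_def)
      have "[u * (s * x + t * y) = u' * (s * x + t * y)] (mod int n)"
        using cong_add[OF cong_mult[OF cong_refl[of s] e(1)] cong_mult[OF cong_refl[of t] e(2)]]
        by (simp add: algebra_simps)
      moreover have "[u * (s * x + t * y) = u] (mod int n)" "[u' * (s * x + t * y) = u'] (mod int n)"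
        using cong_mult[OF cong_refl st] by (metis mult.right_neutral)+
      ultimately have "[u = u'] (mod int n)" by (metis cong_sym cong_trans)
      then show "u = u'" using u by (simp add: cong_def carrier_residue_ring)
    qed
  qed
  then show ?thesis using True by (simp add: admissible_def)
qed (simp add: admissible_def)

text \<open>Multiples of \<open>w\<close> have zero determinant with \<open>w\<close>; conversely,
  the Bezout coefficients of \<open>w\<close> produce the scalar explicitly.\<close>

lemma mem_cyclic_submodule_Zmod_iff:
  assumes n: "n > 1" and v: "v \<in> vecs (Zmod n)" and w: "unimodular n w"
  shows "v \<in> cyclic_submodule (Zmod n) w \<longleftrightarrow> collinear n v w"
proof -
  obtain x y where xy: "w = (x, y)" by fastforce
  obtain b c where bc: "v = (b, c)" by fastforce
  show ?thesis
  proof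
    assume "v \<in> cyclic_submodule (Zmod n) w"
    then obtain u where "v = scale (Zmod n) u w" by (auto simp: cyclic_submodule_def)
    then have "[b = u * x] (mod int n)" "[c = u * y] (mod int n)"
      by (auto simp: scale_def mult_residue_ring xy bc cong_def)
    then have "[x * c - y * b = x * (u * y) - y * (u * x)] (mod int n)"
      by (intro cong_diff cong_mult cong_refl)
    then show "collinear n v w"
      by (simp add: collinear_def xy bc cong_0_iff algebra_simps)
  next
    assume "collinear n v w"
    then have col: "[x * c = y * b] (mod int n)"
      by (simp add: collinear_def xy bc cong_iff_dvd_diff)
    obtain s t where st: "[s * x + t * y = 1] (mod int n)"
      using unimodular_bezout[OF w] xy by auto
    \<comment> \<open>If \<open>v = u w\<close> then \<open>s b + t c = u (s x + t y) = u\<close>,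
      so this is the only candidate.\<close>
    define u where "u = (s * b + t * c) mod int n"
    have u: "[u = s * b + t * c] (mod int n)" by (simp add: u_def cong_def)
    have "[u * x = b] (mod int n)"
    proof -
      have "[u * x = (s * b + t * c) * x] (mod int n)" by (intro cong_mult u cong_refl)
      \<comment> \<open>Isolating \<open>x * c\<close> lets \<open>col\<close> trade it for
        \<open>y * b\<close>, after which \<open>b\<close> factors out next to the Bezout
        sum.\<close>
      also have "(s * b + t * c) * x = s * b * x + t * (x * c)" by (simp add: algebra_simps)
      also have "[\<dots> = s * b * x + t * (y * b)] (mod int n)"
        by (intro cong_mult cong_add col cong_refl)
      also have "s * b * x + t * (y * b) = b * (s * x + t * y)" by (simp add: algebra_simps)
      also have "[\<dots> = b * 1] (mod int n)" by (intro cong_mult st cong_refl)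
      finally show ?thesis by simp
    qed
    moreover have "[u * y = c] (mod int n)"
    proof -
      have "[u * y = (s * b + t * c) * y] (mod int n)" by (intro cong_mult u cong_refl)
      also have "(s * b + t * c) * y = s * (y * b) + t * c * y" by (simp add: algebra_simps)
      also have "[\<dots> = s * (x * c) + t * c * y] (mod int n)"
        by (intro cong_mult cong_add cong_sym[OF col] cong_refl)
      also have "s * (x * c) + t * c * y = c * (s * x + t * y)" by (simp add: algebra_simps)
      also have "[\<dots> = c * 1] (mod int n)" by (intro cong_mult st cong_refl)
      finally show ?thesis by simp
    qed
    ultimately have "v = scale (Zmod n) u w"
      using v by (auto simp: scale_def mult_residue_ring xy bc cong_def carrier_residue_ring)
    moreover have "u \<in> carrier (Zmod n)" using n by (simp add: u_def carrier_residue_ring)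
    ultimately show "v \<in> cyclic_submodule (Zmod n) w"
      by (auto simp: cyclic_submodule_def)
  qed
qed

text \<open>Trades submodules for vectors cut out by congruences, a count that is multiplicative
  over coprime moduli.\<close>

lemma totient_times_card_points_Zmod:
  assumes n: "n > 1" and v: "v \<in> vecs (Zmod n)"
  shows "totient n * card {L \<in> proj_line (Zmod n). v \<in> L}
       = card {w \<in> vecs (Zmod n). unimodular n w \<and> collinear n v w}"
proof -
  interpret residues "int n" "Zmod n" using residues_Zmod[OF n] by simp
  have "{w. admissible (Zmod n) w \<and> v \<in> cyclic_submodule (Zmod n) w}
      = {w \<in> vecs (Zmod n). unimodular n w \<and> collinear n v w}"
    by (intro Collect_cong)
       (use admissible_Zmod_iff[OF n] mem_cyclic_submodule_Zmod_iff[OF n v] in metis)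
  then show ?thesis
    using card_Units_times_card_points[OF cring, of v] by (simp add: card_Units_Zmod[OF n])
qed

lemma perp_Zmod:
  assumes n: "n > 1"
  shows "perp (Zmod n) v = {w \<in> vecs (Zmod n). collinear n v w}"
proof -
  interpret residues "int n" "Zmod n" using residues_Zmod[OF n] by simp
  have "symp (Zmod n) v w = \<zero>\<^bsub>Zmod n\<^esub> \<longleftrightarrow> collinear n v w" for w
  proof -
    have "symp (Zmod n) v w = \<zero>\<^bsub>Zmod n\<^esub>
        \<longleftrightarrow> (snd v * fst w) mod int n = (snd w * fst v) mod int n"
      unfolding symp_def by (subst r_right_minus_eq) (simp_all only: mult_residue_ring mod_in_carrier)
    also have "\<dots> \<longleftrightarrow> collinear n v w"
      by (simp add: collinear_def mod_eq_dvd_iff mult.commute)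
    finally show ?thesis .
  qed
  then show ?thesis by (simp add: perp_def)
qed

section \<open>Chinese remaindering of counts\<close>

text \<open>Modulus 1 arises as the empty product of prime powers; the simplifier turns
  \<open>1\<close> into \<open>Suc 0\<close>, hence the form of this rule and the next.\<close>

lemma collinear_Suc_0 [simp]: "collinear (Suc 0) v w"
  by (simp add: collinear_def)

lemma unimodular_Suc_0 [simp]: "unimodular (Suc 0) w"
  by (simp add: unimodular_def)

lemma collinear_mult:
  assumes "coprime m n"
  shows "collinear (m * n) v w \<longleftrightarrow> collinear m v w \<and> collinear n v w"
proof -
  have "coprime (int m) (int n)" using assms by simp
  then show ?thesis
    unfolding collinear_def of_nat_mult
    by (meson divides_mult dvd_mult_left dvd_mult_right)
qed

lemma collinear_cong:
  assumes "[fst v = fst v'] (mod int n)" "[snd v = snd v'] (mod int n)"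
    and "[fst w = fst w'] (mod int n)" "[snd w = snd w'] (mod int n)"
  shows "collinear n v w \<longleftrightarrow> collinear n v' w'"
proof -
  have "[fst w * snd v - snd w * fst v = fst w' * snd v' - snd w' * fst v'] (mod int n)"
    by (intro cong_diff cong_mult assms)
  then show ?thesis unfolding collinear_def by (rule cong_dvd_iff)
qed

lemma unimodular_mult: "unimodular (m * n) w \<longleftrightarrow> unimodular m w \<and> unimodular n w"
  by (simp add: unimodular_def)

text \<open>Since \<open>gcd (x mod n) n = gcd x n\<close>, the modulus can be moved next to each
  coordinate in turn inside the triple gcd.\<close>

lemma unimodular_reduce_vec: "unimodular n (reduce_vec n w) \<longleftrightarrow> unimodular n w"
proof -
  have red: "gcd (x mod int n) (int n) = gcd x (int n)" for x
    by (metis gcd.commute gcd_red_int)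
  have "gcd (gcd (x mod int n) (y mod int n)) (int n) = gcd (gcd x y) (int n)" for x y
  proof -
    have "gcd (gcd (x mod int n) (y mod int n)) (int n) = gcd (gcd x (int n)) (y mod int n)"
      by (simp only: red[of x, symmetric] ac_simps)
    also have "\<dots> = gcd x (gcd (y mod int n) (int n))"
      by (simp only: ac_simps)
    also have "\<dots> = gcd (gcd x y) (int n)"
      by (simp only: red gcd.assoc)
    finally show ?thesis .
  qed
  then show ?thesis
    by (simp only: unimodular_def reduce_vec_def coprime_iff_gcd_eq_1 fst_conv snd_conv)
qed

lemma collinear_reduce_vec: "collinear n v (reduce_vec n w) \<longleftrightarrow> collinear n v w"
  by (rule collinear_cong) (auto simp: reduce_vec_def cong_def)

text \<open>The Chinese remainder bijection, applied to each coordinate, carries the vectors counted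
  modulo \<open>m * n\<close> onto the pairs counted modulo \<open>m\<close> and \<open>n\<close>.
  The predicate takes the modulus as an argument so that one lemma serves both the points and the
  perp-set.\<close>

lemma card_residue_vecs_mult:
  fixes P :: "nat \<Rightarrow> int \<times> int \<Rightarrow> bool"
  assumes cop: "coprime m n" and pos: "m > 0" "n > 0"
    and P: "\<And>w. P (m * n) w \<longleftrightarrow> P m (reduce_vec m w) \<and> P n (reduce_vec n w)"
  shows "card {w \<in> vecs (Zmod (m * n)). P (m * n) w}
       = card {w \<in> vecs (Zmod m). P m w} * card {w \<in> vecs (Zmod n). P n w}"
proof -
  let ?A = "\<lambda>n. {w \<in> vecs (Zmod n). P n w}"
  let ?f = "\<lambda>w. (reduce_vec m w, reduce_vec n w)"
  have cop': "coprime (int m) (int n)" using cop by simp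
  \<comment> \<open>Uniqueness and existence for single residues: \<open>eq\<close> will give
    injectivity and \<open>ex\<close> surjectivity on pairs.\<close>
  have eq: "x = y" if "x mod int m = y mod int m" "x mod int n = y mod int n"
    "x \<in> {0..<int (m * n)}" "y \<in> {0..<int (m * n)}" for x y
  proof -
    have "[x = y] (mod (int m * int n))"
      using that(1,2) cop' by (intro coprime_cong_mult) (auto simp: cong_def)
    then show ?thesis using that(3,4) by (simp add: cong_def)
  qed
  have ex: "\<exists>x\<in>{0..<int (m * n)}. x mod int m = y \<and> x mod int n = z"
    if "y \<in> {0..<int m}" "z \<in> {0..<int n}" for y z
  proof -
    obtain x where x: "[x = y] (mod int m)" "[x = z] (mod int n)"
      using binary_chinese_remainder_int[OF cop'] by blast
    let ?x = "x mod (int m * int n)"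
    have "?x mod int m = y" "?x mod int n = z"
      using x that by (auto simp: cong_def mod_mod_cancel)
    moreover have "?x \<in> {0..<int (m * n)}" using pos by simp
    ultimately show ?thesis by blast
  qed
  have "bij_betw ?f (?A (m * n)) (?A m \<times> ?A n)"
    unfolding bij_betw_def
  proof
    show "inj_on ?f (?A (m * n))"
    proof (rule inj_onI)
      fix w w' assume "w \<in> ?A (m * n)" "w' \<in> ?A (m * n)" "?f w = ?f w'"
      then have
        "fst w mod int m = fst w' mod int m" "fst w mod int n = fst w' mod int n"
        "snd w mod int m = snd w' mod int m" "snd w mod int n = snd w' mod int n"
        "{fst w, fst w', snd w, snd w'} \<subseteq> {0..<int (m * n)}"
        by (auto simp: reduce_vec_def carrier_residue_ring)
      then show "w = w'" using eq[of "fst w" "fst w'"] eq[of "snd w" "snd w'"]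
        by (simp add: prod_eq_iff)
    qed
    show "?f ` ?A (m * n) = ?A m \<times> ?A n"
    proof (intro equalityI subsetI)
      fix z assume "z \<in> ?f ` ?A (m * n)"
      then show "z \<in> ?A m \<times> ?A n"
        using P pos by (auto simp: carrier_residue_ring reduce_vec_def)
    next
      fix z assume z: "z \<in> ?A m \<times> ?A n"
      obtain a b a' b' where zz: "z = ((a, b), (a', b'))" by (metis surj_pair)
      obtain x where x: "x \<in> {0..<int (m * n)}" "x mod int m = a" "x mod int n = a'"
        using ex[of a a'] z zz by (auto simp: carrier_residue_ring)
      obtain y where y: "y \<in> {0..<int (m * n)}" "y mod int m = b" "y mod int n = b'"
        using ex[of b b'] z zz by (auto simp: carrier_residue_ring)
      have f: "reduce_vec m (x, y) = (a, b)" "reduce_vec n (x, y) = (a', b')"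
        using x y by (simp_all add: reduce_vec_def)
      have "P m (a, b)" "P n (a', b')" using z zz by auto
      then have "P (m * n) (x, y)" using P[of "(x, y)"] f by metis
      then have "(x, y) \<in> ?A (m * n)"
        using x(1) y(1) by (simp add: carrier_residue_ring)
      moreover have "z = ?f (x, y)" using f zz by simp
      ultimately show "z \<in> ?f ` ?A (m * n)" by (rule rev_image_eqI)
    qed
  qed
  then have "card (?A (m * n)) = card (?A m \<times> ?A n)"
    by (rule bij_betw_same_card)
  then show ?thesis by (simp only: card_cartesian_product)
qed

lemma card_residue_vecs_prod:
  fixes P :: "nat \<Rightarrow> int \<times> int \<Rightarrow> bool"
  assumes "finite I" "\<And>i. i \<in> I \<Longrightarrow> f i > 0"
    and "\<And>i j. i \<in> I \<Longrightarrow> j \<in> I \<Longrightarrow> i \<noteq> j \<Longrightarrow> coprime (f i) (f j)"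
    and one: "P 1 (0, 0)"
    and P: "\<And>m n w. coprime m n \<Longrightarrow>
              P (m * n) w \<longleftrightarrow> P m (reduce_vec m w) \<and> P n (reduce_vec n w)"
  shows "card {w \<in> vecs (Zmod (\<Prod>i\<in>I. f i)). P (\<Prod>i\<in>I. f i) w}
       = (\<Prod>i\<in>I. card {w \<in> vecs (Zmod (f i)). P (f i) w})"
  using assms(1-3)
proof (induction I rule: finite_induct)
  case empty
  \<comment> \<open>The only residue modulo 1 is 0, so the empty product 1 matches the single zero
    vector.\<close>
  have "{w \<in> vecs (Zmod 1). P 1 w} = {(0, 0)}"
    using one by (auto simp: carrier_residue_ring)
  then show ?case by simp
next
  case (insert i I)
  have "coprime (f i) (\<Prod>i\<in>I. f i)"
    by (rule prod_coprime_right) (use insert in auto)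
  moreover have "(\<Prod>i\<in>I. f i) > 0" using insert by (intro prod_pos) auto
  ultimately have "card {w \<in> vecs (Zmod (f i * (\<Prod>i\<in>I. f i))). P (f i * (\<Prod>i\<in>I. f i)) w}
     = card {w \<in> vecs (Zmod (f i)). P (f i) w}
       * card {w \<in> vecs (Zmod (\<Prod>i\<in>I. f i)). P (\<Prod>i\<in>I. f i) w}"
    using insert P by (intro card_residue_vecs_mult) auto
  then show ?case using insert by simp
qed

section \<open>Counts modulo a prime power\<close>

text \<open>As \<open>a\<close> is invertible modulo \<open>m\<close>, the congruence fixes
  \<open>y\<close> modulo \<open>m\<close>, and a range of length \<open>m * k\<close> contains
  \<open>k\<close> lifts of each residue.\<close>

lemma card_linear_congruence:
  fixes m k :: nat and a c :: int
  assumes m: "m > 0" and a: "coprime a (int m)"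
  shows "card {y \<in> {0..<int (m * k)}. int m dvd c - y * a} = k"
proof -
  obtain a' where a': "[a * a' = 1] (mod int m)"
    using cong_solve_coprime_int[OF a] by blast
  define t where "t = (c * a') mod int m"
  have t: "0 \<le> t" "t < int m" using m by (simp_all add: t_def)
  have iff: "int m dvd c - y * a \<longleftrightarrow> y mod int m = t" for y
  proof -
    have "int m dvd c - y * a \<longleftrightarrow> [y * a = c] (mod int m)"
      by (simp add: cong_iff_dvd_diff dvd_diff_commute)
    also have "\<dots> \<longleftrightarrow> [y = c * a'] (mod int m)"
    proof
      assume "[y * a = c] (mod int m)"
      then have "[y * a * a' = c * a'] (mod int m)" by (rule cong_mult) simp
      moreover have "[y * (a * a') = y * 1] (mod int m)" by (intro cong_mult a') simp
      ultimately show "[y = c * a'] (mod int m)"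
        by (simp add: mult.assoc) (metis cong_sym cong_trans)
    next
      assume "[y = c * a'] (mod int m)"
      then have "[y * a = c * a' * a] (mod int m)" by (rule cong_mult) simp
      moreover have "[c * (a * a') = c * 1] (mod int m)" by (intro cong_mult a') simp
      ultimately show "[y * a = c] (mod int m)"
        by (simp add: ac_simps) (metis cong_trans)
    qed
    finally show ?thesis by (simp add: t_def cong_def)
  qed
  have "{y \<in> {0..<int (m * k)}. int m dvd c - y * a} = (\<lambda>j. t + int m * int j) ` {..<k}"
    (is "?L = ?R")
  proof (intro equalityI subsetI)
    fix y assume "y \<in> ?L"
    then have y: "0 \<le> y" "y < int m * int k" "y mod int m = t" using iff by auto
    define j where "j = y div int m"
    have eq: "y = t + int m * j" using y(3) by (simp add: j_def flip: y(3))
    have "0 \<le> j" using y(1) m by (simp add: j_def pos_imp_zdiv_nonneg_iff)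
    moreover have "j < int k"
    proof -
      have "int m * j < int m * int k" using eq t(1) y(2) by linarith
      then show ?thesis using m by simp
    qed
    ultimately have "y = t + int m * int (nat j)" "nat j \<in> {..<k}"
      using eq by auto
    then show "y \<in> ?R" by blast
  next
    fix y assume "y \<in> ?R"
    then obtain j where j: "j < k" "y = t + int m * int j" by blast
    have "y mod int m = t" using j t by simp
    moreover have "y < int m * int k"
    proof -
      have "int m * (int j + 1) \<le> int m * int k"
        by (intro mult_left_mono) (use j in auto)
      then show ?thesis using t j(2) by (simp add: algebra_simps)
    qed
    moreover have "0 \<le> y" using j t by simp
    ultimately show "y \<in> ?L" by (simp add: iff)
  qed
  moreover have "inj_on (\<lambda>j. t + int m * int j) {..<k}"
    using m by (auto intro: inj_onI)
  ultimately show ?thesis by (simp add: card_image)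
qed

text \<open>Since \<open>x\<close> is a unit modulo \<open>m\<close>, each first coordinate leaves
  one residue modulo \<open>m\<close>, hence \<open>k\<close> lifts, for the second.
  \<open>Q\<close> is a slot for a further condition on the first coordinate, later trivial or
  coprimality.\<close>

lemma card_collinear_with_first_coordinate:
  fixes m k :: nat and x y :: int
  assumes m: "m > 0" and x: "coprime x (int m)"
  shows "card {w \<in> vecs (Zmod (m * k)). Q (fst w) \<and> collinear m (x, y) w}
       = card {a \<in> {0..<int (m * k)}. Q a} * k"
proof -
  let ?S = "{a \<in> {0..<int (m * k)}. Q a}"
  let ?B = "\<lambda>a. {b \<in> {0..<int (m * k)}. int m dvd a * y - b * x}"
  have "{w \<in> vecs (Zmod (m * k)). Q (fst w) \<and> collinear m (x, y) w} = Sigma ?S ?B"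
    by (auto simp: carrier_residue_ring collinear_def)
  moreover have "card (Sigma ?S ?B) = (\<Sum>a\<in>?S. card (?B a))"
  proof (rule card_SigmaI)
    have fin: "finite {a \<in> {0..<int (m * k)}. P a}" for P
      by (rule finite_subset[OF _ finite_atLeastLessThan_int]) blast
    show "finite ?S" by (rule fin)
    show "\<forall>a\<in>?S. finite (?B a)" by (intro ballI fin)
  qed
  moreover have "(\<Sum>a\<in>?S. card (?B a)) = (\<Sum>a\<in>?S. k)"
    by (intro sum.cong refl card_linear_congruence[OF m x])
  ultimately show ?thesis by simp
qed

text \<open>Exchanging coordinates reduces the case where \<open>y\<close> is the unit to the case
  where \<open>x\<close> is.\<close>

lemma card_vecs_swap: "card {w \<in> vecs R. P (prod.swap w)} = card {w \<in> vecs R. P w}"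
proof -
  have "{w \<in> vecs R. P w} = prod.swap ` {w \<in> vecs R. P (prod.swap w)}"
    by force
  then show ?thesis by (simp add: card_image)
qed

lemma collinear_swap: "collinear n (prod.swap v) (prod.swap w) \<longleftrightarrow> collinear n v w"
  unfolding collinear_def by (simp add: dvd_diff_commute)

text \<open>The determinant is linear in the first vector, so a common factor of that vector and the
  modulus cancels.\<close>

lemma collinear_scaled:
  assumes "k > 0"
  shows "collinear (m * k) (int k * x, int k * y) w \<longleftrightarrow> collinear m (x, y) w"
proof -
  have "fst w * (int k * y) - snd w * (int k * x) = (fst w * y - snd w * x) * int k"
    by (simp add: algebra_simps)
  then show ?thesis using assms by (simp add: collinear_def)
qed

lemma card_coprime_residues:
  assumes n: "n > 1"
  shows "card {a \<in> {0..<int n}. coprime a (int n)} = totient n"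
proof -
  interpret residues "int n" "Zmod n" using residues_Zmod[OF n] by simp
  have "\<not> coprime 0 (int n)" using n by simp
  then have "0 \<le> a \<and> a < int n \<and> coprime a (int n) \<longleftrightarrow> 0 < a \<and> a < int n \<and> coprime a (int n)" for a
    by (cases "a = 0") auto
  then have "{a \<in> {0..<int n}. coprime a (int n)} = Units (Zmod n)"
    by (simp add: res_units_eq)
  then show ?thesis by (simp add: card_Units_Zmod[OF n])
qed

lemma unimodular_prime_power:
  assumes p: "prime p" and e: "e \<ge> 1"
  shows "unimodular (p ^ e) w \<longleftrightarrow> \<not> (int p dvd fst w \<and> int p dvd snd w)"
proof -
  have "unimodular (p ^ e) w \<longleftrightarrow> coprime (gcd (fst w) (snd w)) (int p)"
    using e by (simp add: unimodular_def)
  also have "\<dots> \<longleftrightarrow> \<not> int p dvd gcd (fst w) (snd w)"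
    by (rule residues_prime.p_coprime_right_int[OF residues_prime.intro[OF p]])
  finally show ?thesis by simp
qed

text \<open>Counted by complement: a vector fails to be unimodular when both coordinates are among
  the \<open>p ^ (e - 1)\<close> multiples of \<open>p\<close>.\<close>

lemma card_unimodular_prime_power:
  assumes p: "prime p" and e: "e \<ge> 1"
  shows "card {w \<in> vecs (Zmod (p ^ e)). unimodular (p ^ e) w}
       = totient (p ^ e) * (p ^ e + p ^ (e - 1))"
proof -
  define Q where "Q = p ^ (e - 1)"
  have pe: "p ^ e = p * Q" using e by (cases e) (auto simp: Q_def)
  have p1: "p > 1" using p by (rule prime_gt_1_nat)
  define D where "D = {a \<in> {0..<int (p * Q)}. int p dvd a}"
  have "card D = Q"
    \<comment> \<open>Multiples of \<open>p\<close> are the solutions \<open>y\<close> of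
      \<open>p dvd 0 - y * 1\<close>.\<close>
    using card_linear_congruence[of p 1 Q 0] p1 by (simp add: D_def)
  have V: "vecs (Zmod (p * Q)) = {0..<int (p * Q)} \<times> {0..<int (p * Q)}"
    by (simp add: carrier_residue_ring)
  have DV: "D \<times> D \<subseteq> vecs (Zmod (p * Q))"
    unfolding V D_def by blast
  have "{w \<in> vecs (Zmod (p ^ e)). unimodular (p ^ e) w} = vecs (Zmod (p * Q)) - D \<times> D"
    unfolding unimodular_prime_power[OF p e] unfolding pe V D_def by auto
  moreover have "card (vecs (Zmod (p * Q)) - D \<times> D) = card (vecs (Zmod (p * Q))) - card (D \<times> D)"
    by (intro card_Diff_subset finite_subset[OF DV] DV) (simp add: carrier_residue_ring)
  moreover have "card (vecs (Zmod (p * Q))) = (p * Q) * (p * Q)"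
    unfolding V card_cartesian_product by (simp del: of_nat_mult)
  ultimately have "card {w \<in> vecs (Zmod (p ^ e)). unimodular (p ^ e) w}
      = (p * Q) * (p * Q) - Q * Q"
    by (simp only: card_cartesian_product \<open>card D = Q\<close>)
  moreover have "totient (p ^ e) = Q * (p - 1)"
    using e p by (simp add: totient_prime_power Q_def)
  \<comment> \<open>A difference of squares, with the factor \<open>p * Q - Q\<close> written as
    \<open>Q * (p - 1)\<close>.\<close>
  moreover have "(p * Q) * (p * Q) - Q * Q = Q * (p - 1) * (p * Q + Q)"
    using p1 by (cases p) (auto simp: algebra_simps)
  ultimately show ?thesis unfolding pe Q_def[symmetric] by simp
qed

text \<open>By maximality of \<open>\<delta>\<close>, dividing out \<open>p ^ \<delta>\<close>
  leaves a coordinate not divisible by \<open>p\<close>, and such a coordinate is a unit modulo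
  every power of \<open>p\<close>.\<close>

lemma prime_power_cofactor:
  assumes p: "prime p" and \<delta>: "\<delta> < e"
    and dvd: "int p ^ \<delta> dvd fst v" "int p ^ \<delta> dvd snd v"
    and max: "\<not> (int p ^ Suc \<delta> dvd fst v \<and> int p ^ Suc \<delta> dvd snd v)"
  obtains x y where "v = (int (p ^ \<delta>) * x, int (p ^ \<delta>) * y)"
    "coprime x (int (p ^ (e - \<delta>))) \<or> coprime y (int (p ^ (e - \<delta>)))"
proof -
  obtain x y where v: "v = (int (p ^ \<delta>) * x, int (p ^ \<delta>) * y)"
    using dvd by (cases v) (auto elim!: dvdE)
  have "\<not> (int p dvd x \<and> int p dvd y)"
    using max by (auto simp: v mult.commute mult_dvd_mono)
  then have "coprime x (int p) \<or> coprime y (int p)"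
    by (simp add: residues_prime.p_coprime_right_int[OF residues_prime.intro[OF p]])
  then have "coprime x (int (p ^ (e - \<delta>))) \<or> coprime y (int (p ^ (e - \<delta>)))"
    by auto
  then show ?thesis using that v by blast
qed

text \<open>For \<open>\<delta> = e\<close> the condition is empty. Otherwise cancelling
  \<open>p ^ \<delta>\<close> lowers the modulus of the condition to
  \<open>p ^ (e - \<delta>)\<close> while \<open>w\<close> still ranges modulo \<open>p ^ e\<close>:
  one coordinate is free and the other has \<open>p ^ \<delta>\<close> lifts.\<close>

lemma card_collinear_prime_power:
  assumes p: "prime p" and \<delta>: "\<delta> \<le> e"
    and dvd: "int p ^ \<delta> dvd fst v" "int p ^ \<delta> dvd snd v"
    and max: "\<delta> < e \<Longrightarrow> \<not> (int p ^ Suc \<delta> dvd fst v \<and> int p ^ Suc \<delta> dvd snd v)"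
  shows "card {w \<in> vecs (Zmod (p ^ e)). collinear (p ^ e) v w} = p ^ (e + \<delta>)"
proof (cases "\<delta> = e")
  case True
  then have "collinear (p ^ e) v w" for w
    using dvd by (simp add: collinear_def)
  then show ?thesis
    using True by (simp add: carrier_residue_ring card_cartesian_product power_add nat_power_eq)
next
  case False
  then have \<delta>: "\<delta> < e" using \<delta> by simp
  define m where "m = p ^ (e - \<delta>)"
  define k where "k = p ^ \<delta>"
  have mk: "p ^ e = m * k" using \<delta> by (simp add: m_def k_def flip: power_add)
  have pos: "m > 0" "k > 0" using p by (simp_all add: m_def k_def prime_gt_0_nat)
  have count: "card {w \<in> vecs (Zmod (m * k)). collinear m (x, y) w} = p ^ (e + \<delta>)"
    if "coprime x (int m)" for x y
  proof -
    have "{a \<in> {0..<int (m * k)}. True} = {0..<int (m * k)}" by blast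
    then have "card {w \<in> vecs (Zmod (m * k)). collinear m (x, y) w} = m * k * k"
      using card_collinear_with_first_coordinate[OF pos(1) that, of k "\<lambda>_. True" y]
      by (simp del: of_nat_mult)
    then show ?thesis by (simp only: power_add mk) (simp add: k_def)
  qed
  obtain x y where v: "v = (int k * x, int k * y)"
    and cop: "coprime x (int m) \<or> coprime y (int m)"
    using prime_power_cofactor[OF p \<delta> dvd max[OF \<delta>]] unfolding m_def k_def by blast
  have "card {w \<in> vecs (Zmod (p ^ e)). collinear (p ^ e) v w}
      = card {w \<in> vecs (Zmod (m * k)). collinear m (x, y) w}"
    by (simp only: v mk collinear_scaled[OF pos(2)])
  also have "\<dots> = p ^ (e + \<delta>)"
    using cop
  proof
    assume "coprime y (int m)"
    moreover have "collinear m (x, y) w \<longleftrightarrow> collinear m (y, x) (prod.swap w)" for w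
      using collinear_swap[of m "(y, x)" "prod.swap w"] by simp
    ultimately show ?thesis
      using count[of y x]
        card_vecs_swap[of "Zmod (m * k)" "\<lambda>w. collinear m (y, x) w"] by simp
  qed (rule count)
  finally show ?thesis .
qed

text \<open>The count is that of all collinear \<open>w\<close>, except that the free coordinate
  must now be a unit, so it has \<open>totient (p ^ e)\<close> values instead of
  \<open>p ^ e\<close>.\<close>

lemma card_unimodular_collinear_prime_power:
  assumes p: "prime p" and \<delta>: "\<delta> < e"
    and dvd: "int p ^ \<delta> dvd fst v" "int p ^ \<delta> dvd snd v"
    and max: "\<not> (int p ^ Suc \<delta> dvd fst v \<and> int p ^ Suc \<delta> dvd snd v)"
  shows "card {w \<in> vecs (Zmod (p ^ e)). unimodular (p ^ e) w \<and> collinear (p ^ e) v w}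
       = totient (p ^ e) * p ^ \<delta>"
proof -
  define m where "m = p ^ (e - \<delta>)"
  define k where "k = p ^ \<delta>"
  have mk: "p ^ e = m * k" using \<delta> by (simp add: m_def k_def flip: power_add)
  have pos: "m > 0" "k > 0" using p by (simp_all add: m_def k_def prime_gt_0_nat)
  have e: "e \<ge> 1" using \<delta> by simp
  \<comment> \<open>The strict inequality \<open>\<delta> < e\<close> matters here: the reduced
    condition still holds modulo \<open>p\<close>.\<close>
  have pm: "int p dvd int m" using \<delta> by (simp add: m_def)
  have pe1: "p ^ e > 1" using e prime_gt_1_nat[OF p] by (simp add: one_less_power del: One_nat_def)
  \<comment> \<open>Modulo \<open>p\<close> the second coordinate of \<open>w\<close> is a multiple
    of the first, because \<open>x\<close> is invertible; so unimodularity is decided by the first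
    alone.\<close>
  have uni: "unimodular (p ^ e) w \<longleftrightarrow> coprime (fst w) (int (p ^ e))"
    if x: "coprime x (int m)" and col: "collinear m (x, y) w" for x y w
  proof -
    have "int p dvd snd w" if "int p dvd fst w"
    proof -
      have "int p dvd fst w * y - snd w * x"
        using dvd_trans[OF pm] col by (simp add: collinear_def)
      then have "int p dvd snd w * x"
        using that by (metis dvd_diffD1 dvd_mult2 dvd_diff_right_iff dvd_triv_left)
      moreover have "coprime (int p) x"
        using x pm by (meson coprime_commute coprime_divisors dvd_refl)
      ultimately show ?thesis by (simp add: coprime_dvd_mult_left_iff)
    qed
    then have "unimodular (p ^ e) w \<longleftrightarrow> \<not> int p dvd fst w"
      by (auto simp: unimodular_prime_power[OF p e])
    also have "\<dots> \<longleftrightarrow> coprime (fst w) (int (p ^ e))"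
      using e by (simp add: residues_prime.p_coprime_right_int[OF residues_prime.intro[OF p]])
    finally show ?thesis .
  qed
  have count: "card {w \<in> vecs (Zmod (m * k)). unimodular (p ^ e) w \<and> collinear m (x, y) w}
      = totient (p ^ e) * p ^ \<delta>" if x: "coprime x (int m)" for x y
  proof -
    have "{w \<in> vecs (Zmod (m * k)). unimodular (p ^ e) w \<and> collinear m (x, y) w}
        = {w \<in> vecs (Zmod (m * k)). coprime (fst w) (int (p ^ e)) \<and> collinear m (x, y) w}"
      using uni[OF x] by blast
    then show ?thesis
      using card_collinear_with_first_coordinate[OF pos(1) x, of k "\<lambda>a. coprime a (int (p ^ e))" y]
        card_coprime_residues[OF pe1]
      by (simp only: mk k_def)
  qed
  obtain x y where v: "v = (int k * x, int k * y)"
    and cop: "coprime x (int m) \<or> coprime y (int m)"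
    using prime_power_cofactor[OF p \<delta> dvd max] unfolding m_def k_def by blast
  have "card {w \<in> vecs (Zmod (p ^ e)). unimodular (p ^ e) w \<and> collinear (p ^ e) v w}
      = card {w \<in> vecs (Zmod (m * k)). unimodular (p ^ e) w \<and> collinear m (x, y) w}"
    by (simp only: v mk collinear_scaled[OF pos(2)])
  also have "\<dots> = totient (p ^ e) * p ^ \<delta>"
    using cop
  proof
    assume "coprime y (int m)"
    moreover have "unimodular (p ^ e) w \<longleftrightarrow> unimodular (p ^ e) (prod.swap w)" for w
      by (simp add: unimodular_def gcd.commute)
    moreover have "collinear m (x, y) w \<longleftrightarrow> collinear m (y, x) (prod.swap w)" for w
      using collinear_swap[of m "(y, x)" "prod.swap w"] by simp
    ultimately show ?thesis
      using count[of y x]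
        card_vecs_swap[of "Zmod (m * k)" "\<lambda>w. unimodular (p ^ e) w \<and> collinear m (y, x) w"]
      by presburger
  qed (rule count)
  finally show ?thesis .
qed

section \<open>Degrees\<close>

text \<open>Reduction modulo \<open>n\<close> preserves divisibility by a divisor \<open>g\<close>
  of \<open>n\<close>, and the quotient of a residue by \<open>g\<close> is again a residue. For
  \<open>g = n\<close> the generator reduces to 0 and both sides say \<open>a = 0\<close>.\<close>

lemma mem_PIdl_Zmod_iff:
  assumes "n > 1" "g dvd n" "a \<in> carrier (Zmod n)"
  shows "a \<in> PIdl\<^bsub>Zmod n\<^esub> (int g mod int n) \<longleftrightarrow> int g dvd a"
proof
  assume "a \<in> PIdl\<^bsub>Zmod n\<^esub> (int g mod int n)"
  then obtain x where "a = x * (int g mod int n) mod int n"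
    by (auto simp: cgenideal_def mult_residue_ring)
  then have "a = x * int g mod int n" by (simp add: mod_mult_right_eq)
  then show "int g dvd a" using assms(2) by (simp add: dvd_mod_iff)
next
  assume g: "int g dvd a"
  have g0: "int g > 0" using assms(1,2) by (auto intro: Nat.gr0I)
  have a: "0 \<le> a" "a < int n" using assms(3) by (auto simp: carrier_residue_ring)
  obtain x where x: "a = int g * x" using g by blast
  have "0 \<le> x" using a(1) g0 by (simp add: x zero_le_mult_iff)
  moreover from this have "x \<le> a"
    using mult_right_mono[of 1 "int g" x] g0 by (simp add: x)
  ultimately have "x \<in> carrier (Zmod n)"
    using a(2) by (simp add: carrier_residue_ring)
  moreover have "a = x * (int g mod int n) mod int n"
    using a by (simp add: x mod_mult_right_eq mult.commute)
  ultimately show "a \<in> PIdl\<^bsub>Zmod n\<^esub> (int g mod int n)"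
    unfolding cgenideal_def mult_residue_ring by blast
qed

text \<open>Translates the ideal-theoretic degree into divisibility of the unreduced integers; this
  works since \<open>p ^ \<kappa>\<close> divides \<open>p ^ e\<close> for
  \<open>\<kappa> \<le> e\<close>.\<close>

lemma prime_power_degree_reduce_vec:
  assumes p: "prime p" and e: "e \<ge> 1"
  shows "prime_power_degree p e (reduce_vec (p ^ e) v)
       = Max {\<kappa> \<in> {0..e}. int p ^ \<kappa> dvd fst v \<and> int p ^ \<kappa> dvd snd v}"
proof -
  have n: "p ^ e > 1" using e prime_gt_1_nat[OF p] by (simp add: one_less_power del: One_nat_def)
  have "x mod int (p ^ e) \<in> PIdl\<^bsub>Zmod (p ^ e)\<^esub> (int (p ^ \<kappa>) mod int (p ^ e))
      \<longleftrightarrow> int p ^ \<kappa> dvd x" if "\<kappa> \<le> e" for \<kappa> x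
  proof -
    have "x mod int (p ^ e) \<in> carrier (Zmod (p ^ e))"
      using n by (intro residues.mod_in_carrier residues_Zmod)
    then show ?thesis
      using mem_PIdl_Zmod_iff[OF n le_imp_power_dvd[OF that]] le_imp_power_dvd[OF that, of "int p"]
      by (simp add: dvd_mod_iff)
  qed
  then show ?thesis
    unfolding prime_power_degree_def reduce_vec_def
    by (intro arg_cong[where f = Max] Collect_cong) auto
qed

text \<open>Restates the maximum in the form expected by the prime power counts. The last item
  identifies the zero components as those of full degree.\<close>

lemma vec_degree_properties:
  assumes p: "prime (p k)" and e: "\<epsilon> k \<ge> 1"
  shows "vec_degree p \<epsilon> v k \<le> \<epsilon> k"
    and "int (p k) ^ vec_degree p \<epsilon> v k dvd fst v" "int (p k) ^ vec_degree p \<epsilon> v k dvd snd v"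
    and "vec_degree p \<epsilon> v k < \<epsilon> k \<Longrightarrow>
      \<not> (int (p k) ^ Suc (vec_degree p \<epsilon> v k) dvd fst v
        \<and> int (p k) ^ Suc (vec_degree p \<epsilon> v k) dvd snd v)"
    and "reduce_vec (p k ^ \<epsilon> k) v = (0, 0) \<longleftrightarrow> vec_degree p \<epsilon> v k = \<epsilon> k"
proof -
  let ?S = "{\<kappa> \<in> {0..\<epsilon> k}. int (p k) ^ \<kappa> dvd fst v \<and> int (p k) ^ \<kappa> dvd snd v}"
  have eq: "vec_degree p \<epsilon> v k = Max ?S"
    unfolding vec_degree_def by (rule prime_power_degree_reduce_vec[OF p e])
  have "0 \<in> ?S" by simp
  then have "Max ?S \<in> ?S" by (intro Max_in) (simp, blast)
  then have mem: "vec_degree p \<epsilon> v k \<in> ?S" by (simp only: eq)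
  have ge: "\<kappa> \<le> vec_degree p \<epsilon> v k" if "\<kappa> \<in> ?S" for \<kappa>
    unfolding eq by (intro Max_ge) (use that in auto)
  show 1: "vec_degree p \<epsilon> v k \<le> \<epsilon> k" "int (p k) ^ vec_degree p \<epsilon> v k dvd fst v"
    "int (p k) ^ vec_degree p \<epsilon> v k dvd snd v" using mem by auto
  show "\<not> (int (p k) ^ Suc (vec_degree p \<epsilon> v k) dvd fst v
        \<and> int (p k) ^ Suc (vec_degree p \<epsilon> v k) dvd snd v)" if "vec_degree p \<epsilon> v k < \<epsilon> k"
    using ge[of "Suc (vec_degree p \<epsilon> v k)"] that by auto
  have "reduce_vec (p k ^ \<epsilon> k) v = (0, 0) \<longleftrightarrow> \<epsilon> k \<in> ?S"
    by (auto simp: reduce_vec_def mod_eq_0_iff_dvd)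
  also have "\<dots> \<longleftrightarrow> vec_degree p \<epsilon> v k = \<epsilon> k"
  proof
    assume "\<epsilon> k \<in> ?S"
    then show "vec_degree p \<epsilon> v k = \<epsilon> k" by (intro le_antisym 1(1) ge)
  next
    assume "vec_degree p \<epsilon> v k = \<epsilon> k"
    then show "\<epsilon> k \<in> ?S" using mem by (simp only:)
  qed
  finally show "reduce_vec (p k ^ \<epsilon> k) v = (0, 0) \<longleftrightarrow> vec_degree p \<epsilon> v k = \<epsilon> k" .
qed

section \<open>Assembling the prime power counts into the product formulas\<close>

theorem theorem5:
  fixes r d :: nat and p \<epsilon> \<delta> :: "nat \<Rightarrow> nat" and b c :: int and K :: "nat set"
  assumes "r \<ge> 1"
    and "\<And>k. k \<in> {1..r} \<Longrightarrow> prime (p k)"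
    and "inj_on p {1..r}"
    and "\<And>k. k \<in> {1..r} \<Longrightarrow> \<epsilon> k \<ge> 1"
    and "d = (\<Prod>k\<in>{1..r}. p k ^ \<epsilon> k)"
    and "(b, c) \<in> vecs (Zmod d)"
    and "\<And>k. k \<in> {1..r} \<Longrightarrow> \<delta> k = vec_degree p \<epsilon> (b, c) k"
    and "K = {k \<in> {1..r}. reduce_vec (p k ^ \<epsilon> k) (b, c) = (0, 0)}"
  shows "card {L \<in> proj_line (Zmod d). (b, c) \<in> L}
           = (\<Prod>j\<in>{1..r} - K. p j ^ \<delta> j) * (\<Prod>k\<in>K. (p k ^ \<epsilon> k + p k ^ (\<epsilon> k - 1)))
       \<and> card (perp (Zmod d) (b, c)) = (\<Prod>k\<in>{1..r}. p k ^ (\<epsilon> k + \<delta> k))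
       \<and> (\<Prod>k\<in>{1..r}. p k ^ (\<epsilon> k + \<delta> k)) = d * (\<Prod>k\<in>{1..r}. p k ^ \<delta> k)"
proof -
  let ?I = "{1..r}"
  let ?q = "\<lambda>k. p k ^ \<epsilon> k"
  let ?v = "(b, c)"
  note prime = assms(2) and \<epsilon> = assms(4) and d = assms(5) and \<delta> = assms(7) and K = assms(8)
  have q1: "?q k > 1" if "k \<in> ?I" for k
    using prime_gt_1_nat[OF prime[OF that]] \<epsilon>[OF that] by (simp add: one_less_power del: One_nat_def)
  have q0: "?q k > 0" if "k \<in> ?I" for k using q1[OF that] by linarith
  have cop: "coprime (?q i) (?q j)" if "i \<in> ?I" "j \<in> ?I" "i \<noteq> j" for i j
  proof -
    have "p i \<noteq> p j" using inj_onD[OF assms(3) _ that(1,2)] that(3) by blast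
    then have "coprime (p i) (p j)" using prime that(1,2) by (intro primes_coprime)
    then show ?thesis by simp
  qed
  have d1: "d > 1"
  proof -
    \<comment> \<open>As \<open>r \<ge> 1\<close>, the index 1 exists and its factor already exceeds
      1.\<close>
    have "?q 1 dvd d" unfolding d by (rule dvd_prodI) (use assms(1) in auto)
    moreover have "d > 0" unfolding d by (rule prod_pos) (use q0 in auto)
    ultimately show ?thesis using q1[of 1] assms(1) dvd_imp_le[of "?q 1" d] by simp
  qed
  have deg: "\<delta> k \<le> \<epsilon> k" "int (p k) ^ \<delta> k dvd fst ?v" "int (p k) ^ \<delta> k dvd snd ?v"
    "\<delta> k < \<epsilon> k \<Longrightarrow> \<not> (int (p k) ^ Suc (\<delta> k) dvd fst ?v \<and> int (p k) ^ Suc (\<delta> k) dvd snd ?v)"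
    "k \<in> K \<longleftrightarrow> \<delta> k = \<epsilon> k" if k: "k \<in> ?I" for k
    using vec_degree_properties[where p = p and \<epsilon> = \<epsilon> and v = ?v and k = k, OF prime[OF k] \<epsilon>[OF k]] k
    unfolding \<delta>[OF k] K by simp_all
  have KI: "K \<subseteq> ?I" using K by blast
  \<comment> \<open>\<open>?N k\<close> will be the number of points modulo
    \<open>p k ^ \<epsilon> k\<close> through the \<open>k\<close>-th component of
    \<open>(b, c)\<close>.\<close>
  let ?N = "\<lambda>k. if k \<in> K then ?q k + p k ^ (\<epsilon> k - 1) else p k ^ \<delta> k"

  \<comment> \<open>Only \<open>w\<close> is reduced modulo the factors; \<open>(b, c)\<close> is
    kept as an integer vector throughout.\<close>
  have "card (perp (Zmod d) ?v) = (\<Prod>k\<in>?I. card {w \<in> vecs (Zmod (?q k)). collinear (?q k) ?v w})"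
    unfolding perp_Zmod[OF d1] unfolding d
    by (rule card_residue_vecs_prod[where P = "\<lambda>n. collinear n ?v"])
      (use q0 cop in \<open>auto simp: collinear_mult collinear_reduce_vec\<close>)
  also have "\<dots> = (\<Prod>k\<in>?I. p k ^ (\<epsilon> k + \<delta> k))"
    by (intro prod.cong refl card_collinear_prime_power deg prime)
  finally have perp: "card (perp (Zmod d) ?v) = (\<Prod>k\<in>?I. p k ^ (\<epsilon> k + \<delta> k))" .

  have count: "card {w \<in> vecs (Zmod (?q k)). unimodular (?q k) w \<and> collinear (?q k) ?v w}
      = totient (?q k) * ?N k" if k: "k \<in> ?I" for k
  proof (cases "k \<in> K")
    case True
    \<comment> \<open>On \<open>K\<close> the degree is full, so the determinant vanishes
      identically and all unimodular vectors are counted.\<close>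
    then have "int (?q k) dvd b" "int (?q k) dvd c" using deg(2,3,5)[OF k] by simp_all
    then have "collinear (?q k) ?v w" for w by (simp add: collinear_def)
    then show ?thesis
      using True card_unimodular_prime_power[OF prime[OF k] \<epsilon>[OF k]] by simp
  next
    case False
    then have "\<delta> k < \<epsilon> k" using deg(1,5)[OF k] by simp
    then show ?thesis
      using False card_unimodular_collinear_prime_power[OF prime[OF k] _ deg(2,3)[OF k]] deg(4)[OF k]
      by simp
  qed
  have "totient d * card {L \<in> proj_line (Zmod d). ?v \<in> L}
      = card {w \<in> vecs (Zmod d). unimodular d w \<and> collinear d ?v w}"
    using totient_times_card_points_Zmod[OF d1 assms(6)] .
  also have "\<dots> = (\<Prod>k\<in>?I. card {w \<in> vecs (Zmod (?q k)).
      unimodular (?q k) w \<and> collinear (?q k) ?v w})"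
    unfolding d
    by (rule card_residue_vecs_prod[where P = "\<lambda>n w. unimodular n w \<and> collinear n ?v w"])
      (use q0 cop in \<open>auto simp: collinear_mult collinear_reduce_vec unimodular_mult
        unimodular_reduce_vec\<close>)
  also have "\<dots> = (\<Prod>k\<in>?I. totient (?q k) * ?N k)"
    by (intro prod.cong refl count)
  also have "\<dots> = totient d * (\<Prod>k\<in>?I. ?N k)"
  proof -
    \<comment> \<open>Equal prime powers at different indices would be coprime to themselves,
      contradicting \<open>q1\<close>. Injectivity is needed as totient multiplicativity is applied
      to an indexed product.\<close>
    have "inj_on ?q ?I"
      by (rule inj_onI) (metis cop q1 coprime_self less_irrefl nat_dvd_1_iff_1)
    moreover have "pairwise coprime (?q ` ?I)"
      by (rule pairwise_imageI) (rule cop)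
    ultimately have "totient d = (\<Prod>k\<in>?I. totient (?q k))"
      unfolding d by (intro totient_prod_coprime)
    then show ?thesis by (simp add: prod.distrib)
  qed
  \<comment> \<open>The positive factor \<open>totient d\<close>, present on both sides,
    cancels.\<close>
  finally have "card {L \<in> proj_line (Zmod d). ?v \<in> L} = (\<Prod>k\<in>?I. ?N k)"
    using d1 by simp
  also have "\<dots> = (\<Prod>k\<in>?I - K. ?N k) * (\<Prod>k\<in>K. ?N k)"
    by (rule prod.subset_diff[OF KI]) simp
  also have "\<dots> = (\<Prod>j\<in>?I - K. p j ^ \<delta> j) * (\<Prod>k\<in>K. (p k ^ \<epsilon> k + p k ^ (\<epsilon> k - 1)))"
    by (intro arg_cong2[where f = times] prod.cong) auto
  finally show ?thesis
    using perp by (simp add: d power_add prod.distrib)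
qed

end
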